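(* Let $q$ be a prime power, let $m,n\ge 1$, and let $\mathcal{C}$ be an $[n,k,d]_{q^m/q}$ code. Then $\mathcal{C}$ is $2$-rank-frameproof if and only if it is rank-metric intersecting.
   Context: Support and rank: fix an $\mathbb{F}_q$-basis $\Gamma$ of $\mathbb{F}_{q^m}$. For $x=(x_1,\dots,x_n)\in\mathbb{F}_{q^m}^n$ let $\mathrm{Mat}_\Gamma(x)\in\mathbb{F}_q^{m\times n}$ be the matrix whose $j$-th column is the coordinate vector of $x_j$ in the basis $\Gamma$. The support $\sigma(x)\subseteq\mathbb{F}_q^n$ is the $\mathbb{F}_q$-row space of $\mathrm{Mat}_\Gamma(x)$, and $\mathrm{rk}(x)=\dim_{\mathbb{F}_q}\sigma(x)$; both are independent of $\Gamma$. An $[n,k,d]_{q^m/q}$ code is an $\mathbb{F}_{q^m}$-linear subspace $\mathcal{C}$ of $\mathbb{F}_{q^m}^n$ with $k=\dim_{\mathbb{F}_{q^m}}\mathcal{C}\ge 1$ and minimum distance $d=\min_{c\in\mathcal{C}\setminus\{0\}}\mathrm{rk}(c)$. The code is rank-metric intersecting if $\sigma(c)\cap\sigma(c')\ne\{0\}$ for all $c,c'\in\mathcal{C}\setminus\{0\}$. For a subset $\mathcal{C}\subseteq\mathbb{F}_{q^m}^n$ and $\mathcal{S}\subseteq\mathcal{C}$, the set of rank-metric descendants of $\mathcal{S}$ is $\mathrm{desc}_{\mathrm{rk}}(\mathcal{S})=\{w\in\mathbb{F}_{q^m}^n : \bigcap_{c\in\mathcal{S}}\sigma(w-c)=\{0\}\}$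 (an empty intersection being $\mathbb{F}_q^n$). For $s\ge 2$, $\mathcal{C}$ is $s$-rank-frameproof if $\mathrm{desc}_{\mathrm{rk}}(\mathcal{S})\cap(\mathcal{C}\setminus\mathcal{S})=\varnothing$ for every $\mathcal{S}\subseteq\mathcal{C}$ with $|\mathcal{S}|\le s$. *)

theory Defs
  imports "HOL-Analysis.Analysis"
begin

text \<open>
  \<^typ>\<open>'q\<close> is the base field of order \<open>q\<close> and \<^typ>\<open>'e\<close> its extension of degree \<open>m = CARD('m)\<close>;
  the inclusion is an explicit embedding \<open>\<iota>\<close>. Vectors of length \<open>n = CARD('n)\<close> are
  elements of \<^typ>\<open>'q ^ 'n\<close> and \<^typ>\<open>'e ^ 'n\<close>.
\<close>

definition field_embedding :: "('q::field \<Rightarrow> 'e::field) \<Rightarrow> bool" where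
  "field_embedding \<iota> \<longleftrightarrow>
     \<iota> 1 = 1 \<and> (\<forall>a b. \<iota> (a + b) = \<iota> a + \<iota> b) \<and> (\<forall>a b. \<iota> (a * b) = \<iota> a * \<iota> b)"

definition ext_scale :: "('q::field \<Rightarrow> 'e::field) \<Rightarrow> 'q \<Rightarrow> 'e \<Rightarrow> 'e" where
  "ext_scale \<iota> a x = \<iota> a * x"

lemma vector_space_ext_scale:
  assumes "field_embedding \<iota>"
  shows "vector_space (ext_scale \<iota>)"
  using assms by unfold_locales (auto simp: field_embedding_def ext_scale_def algebra_simps)

text \<open>Bases are indexed families, so that the rows of the coordinate matrix are indexed by \<^typ>\<open>'m\<close>.\<close>

definition ext_basis :: "('q::field \<Rightarrow> 'e::field) \<Rightarrow> ('m::finite \<Rightarrow> 'e) \<Rightarrow> bool" where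
  "ext_basis \<iota> \<Gamma> \<longleftrightarrow>
     inj \<Gamma> \<and> \<not> module.dependent (ext_scale \<iota>) (range \<Gamma>) \<and>
     module.span (ext_scale \<iota>) (range \<Gamma>) = UNIV"

definition coord_mat ::
  "('q::field \<Rightarrow> 'e::field) \<Rightarrow> ('m::finite \<Rightarrow> 'e) \<Rightarrow> 'e ^ 'n::finite \<Rightarrow> 'q ^ 'n ^ 'm" where
  "coord_mat \<iota> \<Gamma> x =
     (\<chi> i j. module.representation (ext_scale \<iota>) (range \<Gamma>) (x $ j) (\<Gamma> i))"

definition rk_supp ::
  "('q::field \<Rightarrow> 'e::field) \<Rightarrow> ('m::finite \<Rightarrow> 'e) \<Rightarrow> 'e ^ 'n::finite \<Rightarrow> ('q ^ 'n) set" where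
  "rk_supp \<iota> \<Gamma> x = vec.span (rows (coord_mat \<iota> \<Gamma> x))"

definition rk ::
  "('q::field \<Rightarrow> 'e::field) \<Rightarrow> ('m::finite \<Rightarrow> 'e) \<Rightarrow> 'e ^ 'n::finite \<Rightarrow> nat" where
  "rk \<iota> \<Gamma> x = vec.dim (rk_supp \<iota> \<Gamma> x)"

definition rank_metric_code ::
  "('q::{field,finite} \<Rightarrow> 'e::{field,finite}) \<Rightarrow> ('m::finite \<Rightarrow> 'e) \<Rightarrow>
   nat \<Rightarrow> nat \<Rightarrow> ('e ^ 'n::finite) set \<Rightarrow> bool" where
  "rank_metric_code \<iota> \<Gamma> k d C \<longleftrightarrow>
     vec.subspace C \<and> vec.dim C = k \<and> k \<ge> 1 \<and> d = Min (rk \<iota> \<Gamma> ` (C - {0}))"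

definition rank_metric_intersecting ::
  "('q::field \<Rightarrow> 'e::field) \<Rightarrow> ('m::finite \<Rightarrow> 'e) \<Rightarrow> ('e ^ 'n::finite) set \<Rightarrow> bool" where
  "rank_metric_intersecting \<iota> \<Gamma> C \<longleftrightarrow>
     (\<forall>c \<in> C - {0}. \<forall>c' \<in> C - {0}. rk_supp \<iota> \<Gamma> c \<inter> rk_supp \<iota> \<Gamma> c' \<noteq> {0})"

definition desc_rk ::
  "('q::field \<Rightarrow> 'e::field) \<Rightarrow> ('m::finite \<Rightarrow> 'e) \<Rightarrow> ('e ^ 'n::finite) set \<Rightarrow> ('e ^ 'n) set" where
  "desc_rk \<iota> \<Gamma> S = {w. (\<Inter>c\<in>S. rk_supp \<iota> \<Gamma> (w - c)) = {0}}"

text \<open>Over the finite field \<^typ>\<open>'e\<close> every \<open>S\<close> is finite, so \<^term>\<open>card S\<close> is the true cardinality.\<close>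

definition rank_frameproof ::
  "('q::{field,finite} \<Rightarrow> 'e::{field,finite}) \<Rightarrow> ('m::finite \<Rightarrow> 'e) \<Rightarrow>
   nat \<Rightarrow> ('e ^ 'n::finite) set \<Rightarrow> bool" where
  "rank_frameproof \<iota> \<Gamma> s C \<longleftrightarrow>
     (\<forall>S \<subseteq> C. card S \<le> s \<longrightarrow> desc_rk \<iota> \<Gamma> S \<inter> (C - S) = {})"

end

theory Submission imports Defs begin

text \<open>By linearity, subtracting the elements of a set \<open>S\<close> of codewords from a
  codeword \<open>w\<close> outside \<open>S\<close> gives nonzero codewords, and with
  \<open>w = 0\<close> every pair of nonzero codewords arises in this way. Hence a codeword
  \<open>w\<close> outside \<open>{a, b}\<close> is a descendant of \<open>{a, b}\<close> exactly
  when the supports of the nonzero codewords \<open>w - a\<close> and \<open>w - b\<close> meet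
  trivially, so the two properties forbid the same configurations.\<close>

theorem theorem6p4:
  fixes \<iota> :: "'q::{field,finite} \<Rightarrow> 'e::{field,finite}"
    and \<Gamma> :: "'m::finite \<Rightarrow> 'e"
    and C :: "('e ^ 'n::finite) set"
    and k d :: nat
  assumes "field_embedding \<iota>"
    and "ext_basis \<iota> \<Gamma>"
    and "rank_metric_code \<iota> \<Gamma> k d C"
  shows "rank_frameproof \<iota> \<Gamma> 2 C \<longleftrightarrow> rank_metric_intersecting \<iota> \<Gamma> C"
proof
  have sub: "vec.subspace C"
    using assms(3) by (simp add: rank_metric_code_def)
  {
    assume fp: "rank_frameproof \<iota> \<Gamma> 2 C"
    show "rank_metric_intersecting \<iota> \<Gamma> C"
      unfolding rank_metric_intersecting_def
    proof (intro ballI)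
      fix c c' assume c: "c \<in> C - {0}" and c': "c' \<in> C - {0}"
      \<comment> \<open>Test the frameproof property at \<open>0\<close>, whose differences to \<open>-c\<close> and \<open>-c'\<close> are \<open>c\<close> and \<open>c'\<close>.\<close>
      let ?S = "{- c, - c'}"
      have "?S \<subseteq> C"
        using c c' sub by (auto intro: vec.subspace_neg)
      moreover have "card ?S \<le> 2"
        by (simp add: card_insert_if)
      ultimately have "desc_rk \<iota> \<Gamma> ?S \<inter> (C - ?S) = {}"
        using fp unfolding rank_frameproof_def by blast
      moreover have "0 \<in> C - ?S"
        using c c' vec.subspace_0[OF sub] by auto
      ultimately have "0 \<notin> desc_rk \<iota> \<Gamma> ?S"
        by blast
      then show "rk_supp \<iota> \<Gamma> c \<inter> rk_supp \<iota> \<Gamma> c' \<noteq> {0}"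
        by (simp add: desc_rk_def)
    qed
  next
    assume int: "rank_metric_intersecting \<iota> \<Gamma> C"
    show "rank_frameproof \<iota> \<Gamma> 2 C"
      unfolding rank_frameproof_def
    proof (intro allI impI equals0I)
      fix S w
      assume S: "S \<subseteq> C" "card S \<le> 2" and w: "w \<in> desc_rk \<iota> \<Gamma> S \<inter> (C - S)"
      have diff: "w - c \<in> C - {0}" if "c \<in> S" for c
        using that S(1) w sub by (auto intro: vec.subspace_diff)
      have triv: "(\<Inter>c\<in>S. rk_supp \<iota> \<Gamma> (w - c)) = {0}"
        using w by (simp add: desc_rk_def)
      have "S \<noteq> {}"
      proof
        assume "S = {}"
        \<comment> \<open>The empty intersection is the whole space, which contains the nonzero
          all-ones vector because the index type \<open>'n\<close> is nonempty.\<close>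
        then have "(1 :: 'q ^ 'n) \<in> {0}"
          using triv by auto
        then show False by simp
      qed
      then have "card S = 1 \<or> card S = 2"
        using S(2) by (simp add: card_gt_0_iff le_Suc_eq numeral_2_eq_2)
      \<comment> \<open>A singleton is the case \<open>a = b\<close>; the intersecting property is
        then applied to one codeword taken twice.\<close>
      then obtain a b where ab: "S = {a, b}"
        by (auto simp: card_1_singleton_iff card_2_iff)
      then have "rk_supp \<iota> \<Gamma> (w - a) \<inter> rk_supp \<iota> \<Gamma> (w - b) \<noteq> {0}"
        using int diff unfolding rank_metric_intersecting_def by blast
      then show False
        using triv ab by simp
    qed
  }
qed

end
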